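(* Let $D\ge 1$, $\lambda>0$, $\phi\in(0,\pi/2]$, and let $\Phi\in C^2(\mathbb{R}^D)$ satisfy $\Phi(q)\ge 0$ for all $q\in\mathbb{R}^D$ and $\int_{\mathbb{R}^D}|q|^2e^{-\Phi(q)}\,dq<\infty$. Then for any $f\in C_c^\infty(\mathbb{R}^{2D})$, $$\int_{\mathbb{R}^{2D}}Lf(z)\,\Pi_{\mathrm{BG}}(dz)=0.$$
   Context: $C_c^\infty(\mathbb{R}^{2D})$ is the space of compactly supported smooth functions $\mathbb{R}^{2D}\to\mathbb{R}$. Let $H(q,p)=\frac{|p|^2}{2}+\Phi(q)$ and $\Pi_{\mathrm{BG}}(dq,dp)=C_0^{-1}(2\pi)^{-D/2}e^{-H(q,p)}\,dq\,dp$ with $C_0=\int_{\mathbb{R}^D}e^{-\Phi(q)}dq$. The RHMC generator is $$Lf(q,p)=\lambda^{-1}\,\mathbb{E}\{f(\Gamma(q,p))-f(q,p)\}+p^T\nabla_qf(q,p)-\nabla\Phi(q)^T\nabla_pf(q,p),$$ where $\Gamma(q,p)=(q,\cos(\phi)p+\sin(\phi)\xi)$ and the expectation is over the standard Gaussian vector $\xi\sim\mathcal N(0,1)^D$. *)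

theory Defs
  imports "HOL-Probability.Probability"
begin

(* C^k functions on a Euclidean space: continuous for k = 0; otherwise Frechet differentiable
   everywhere with all directional derivatives of class C^(k-1). *)
primrec C_k :: "nat \<Rightarrow> ('a::euclidean_space \<Rightarrow> real) \<Rightarrow> bool" where
  "C_k 0 f \<longleftrightarrow> continuous_on UNIV f"
| "C_k (Suc k) f \<longleftrightarrow>
     (\<forall>x. f differentiable (at x)) \<and> (\<forall>v. C_k k (\<lambda>x. frechet_derivative f (at x) v))"

definition Cc_infinity :: "('a::euclidean_space \<Rightarrow> real) set" where
  "Cc_infinity = {f. (\<forall>k. C_k k f) \<and> compact (closure (support_on UNIV f))}"

(* Meaningful where f is differentiable; the gradient there is unique. *)
definition grad :: "('a::euclidean_space \<Rightarrow> real) \<Rightarrow> 'a \<Rightarrow> 'a" where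
  "grad f x = (THE D. GDERIV f x :> D)"

definition std_gaussian :: "(real ^ 'n) measure" where
  "std_gaussian = density lborel (\<lambda>x. ennreal (\<Prod>i\<in>UNIV. std_normal_density (x $ i)))"

definition Hamiltonian :: "(real ^ 'n \<Rightarrow> real) \<Rightarrow> (real ^ 'n) \<times> (real ^ 'n) \<Rightarrow> real" where
  "Hamiltonian \<Phi> = (\<lambda>(q, p). (norm p)\<^sup>2 / 2 + \<Phi> q)"

definition C0 :: "(real ^ 'n \<Rightarrow> real) \<Rightarrow> real" where
  "C0 \<Phi> = (\<integral>q. exp (- \<Phi> q) \<partial>lborel)"

definition Pi_BG :: "(real ^ 'n \<Rightarrow> real) \<Rightarrow> ((real ^ 'n) \<times> (real ^ 'n)) measure" where
  "Pi_BG \<Phi> = density lborel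
     (\<lambda>z. ennreal (inverse (C0 \<Phi>) * (2 * pi) powr (- real CARD('n) / 2) * exp (- Hamiltonian \<Phi> z)))"

(* The random map, as a function of the current state and of the Gaussian vector xi. *)
definition Gamma_map ::
  "real \<Rightarrow> (real ^ 'n) \<times> (real ^ 'n) \<Rightarrow> real ^ 'n \<Rightarrow> (real ^ 'n) \<times> (real ^ 'n)" where
  "Gamma_map \<phi> = (\<lambda>(q, p) \<xi>. (q, cos \<phi> *\<^sub>R p + sin \<phi> *\<^sub>R \<xi>))"

definition RHMC_generator ::
  "real \<Rightarrow> real \<Rightarrow> (real ^ 'n \<Rightarrow> real) \<Rightarrow> ((real ^ 'n) \<times> (real ^ 'n) \<Rightarrow> real)
     \<Rightarrow> (real ^ 'n) \<times> (real ^ 'n) \<Rightarrow> real" where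
  "RHMC_generator lam \<phi> \<Phi> f = (\<lambda>(q, p).
     inverse lam * (\<integral>\<xi>. (f (Gamma_map \<phi> (q, p) \<xi>) - f (q, p)) \<partial>std_gaussian)
     + p \<bullet> grad (\<lambda>q'. f (q', p)) q
     - grad \<Phi> q \<bullet> grad (\<lambda>p'. f (q, p')) p)"

end

theory Submission
  imports Defs
begin

text \<open>The generator is the sum of a jump part, which refreshes the momentum, and a transport part,
  which follows the Hamiltonian vector field. Each part integrates to zero separately. Both
  arguments use that the target is a product of a finite position measure with density
  proportional to \<open>exp (- \<Phi>)\<close> and the standard Gaussian measure of the momenta
  (\<open>Pi_BG_eq_pair_measure\<close>), so that bounded measurable functions are integrable and Fubini's
  theorem applies.

  For the jump part, if \<open>p\<close> and \<open>\<xi>\<close> are independent standard Gaussian vectors, then so is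
  \<open>cos \<phi> p + sin \<phi> \<xi>\<close> (\<open>distr_std_gaussian_rotation\<close>). So, for each position, \<open>f (\<Gamma> (q, p))\<close> and
  \<open>f (q, p)\<close> have the same expectation over the momenta (\<open>momentum_refreshment_preserves\<close>).
  The invariance of the Gaussian comes from the symmetry of the joint density of the old and the
  new momentum (\<open>gaussian_kernel_symmetric\<close>).

  For the transport part, write the integrand against \<open>exp (- H)\<close> as a difference of two
  directional derivatives: that of \<open>f exp (- H)\<close> along \<open>p\<close> in the positions, and that of the same
  function along \<open>grad \<Phi> q\<close> in the momenta. The two terms in which \<open>exp (- H)\<close> is differentiated
  cancel, since the vector field is tangent to the level sets of \<open>H\<close>. As \<open>f\<close> has compact
  support, each directional derivative integrates to zero (\<open>integral_directional_derivative_eq_0\<close>,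
  a consequence of translation invariance of Lebesgue measure), which gives
  \<open>transport_preserves\<close>.\<close>

section \<open>The standard Gaussian measure and its rotation invariance\<close>

lemma prod_std_normal_density:
  fixes x :: "real ^ 'n"
  shows "(\<Prod>i\<in>UNIV. std_normal_density (x $ i))
    = (2 * pi) powr (- real CARD('n) / 2) * exp (- (norm x)\<^sup>2 / 2)"
proof -
  have c: "1 / sqrt (2 * pi) = (2 * pi) powr (- 1 / 2)"
    using powr_minus[of "2 * pi" "1 / 2"] by (simp add: powr_half_sqrt inverse_eq_divide)
  have "(\<Prod>i\<in>UNIV. std_normal_density (x $ i))
      = (\<Prod>i\<in>(UNIV::'n set). 1 / sqrt (2 * pi)) * (\<Prod>i\<in>UNIV. exp (- (x $ i)\<^sup>2 / 2))"
    by (simp only: std_normal_density_def prod.distrib)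
  also have "(\<Prod>i\<in>(UNIV::'n set). 1 / sqrt (2 * pi)) = (2 * pi) powr (- real CARD('n) / 2)"
    unfolding c by (simp add: powr_power)
  also have "(\<Prod>i\<in>UNIV. exp (- (x $ i)\<^sup>2 / 2)) = exp (\<Sum>i\<in>UNIV. - (x $ i)\<^sup>2 / 2)"
    by (simp add: exp_sum)
  also have "(\<Sum>i\<in>UNIV. - (x $ i)\<^sup>2 / 2) = - (norm x)\<^sup>2 / 2"
    unfolding power2_norm_eq_inner
    by (simp add: inner_vec_def power2_eq_square sum_negf sum_divide_distrib)
  finally show ?thesis .
qed

lemma borel_measurable_prod_std_normal_density [measurable]:
  "(\<lambda>x::real ^ 'n. \<Prod>i\<in>UNIV. std_normal_density (x $ i)) \<in> borel_measurable borel"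
  unfolding prod_std_normal_density by measurable

lemma prob_space_std_gaussian: "prob_space (std_gaussian :: (real ^ 'n) measure)"
proof
  have one: "(\<integral>\<^sup>+x. ennreal (std_normal_density x) \<partial>lborel) = 1"
    using prob_space_normal_density[of 1 0, THEN prob_space.emeasure_space_1]
    by (simp add: emeasure_density)
  have "emeasure (std_gaussian :: (real ^ 'n) measure) (space std_gaussian)
      = (\<integral>\<^sup>+x. ennreal (\<Prod>i\<in>UNIV. std_normal_density ((x::real ^ 'n) $ i)) \<partial>lborel)"
    by (simp add: std_gaussian_def emeasure_density)
  also have "\<dots> = (\<integral>\<^sup>+x. (\<Prod>b\<in>Basis. ennreal (std_normal_density ((x::real ^ 'n) \<bullet> b))) \<partial>lborel)"
  proof (rule nn_integral_cong)
    fix x :: "real ^ 'n"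
    have inj: "inj (\<lambda>i::'n. axis i (1::real))"
      by (simp add: inj_on_def axis_eq_axis)
    have "(\<Prod>b\<in>Basis. std_normal_density (x \<bullet> b))
        = (\<Prod>b\<in>range (\<lambda>i::'n. axis i (1::real)). std_normal_density (x \<bullet> b))"
      by (rule arg_cong[where f="prod _"]) (auto simp: Basis_vec_def)
    also have "\<dots> = (\<Prod>i\<in>UNIV. std_normal_density (x $ i))"
      by (subst prod.reindex[OF inj]) (simp add: inner_axis)
    finally show "ennreal (\<Prod>i\<in>UNIV. std_normal_density (x $ i))
        = (\<Prod>b\<in>Basis. ennreal (std_normal_density (x \<bullet> b)))"
      by (simp add: prod_ennreal)
  qed
  also have "\<dots> = 1"
    by (subst nn_integral_lborel_prod) (auto simp: one)
  finally show "emeasure (std_gaussian :: (real ^ 'n) measure) (space std_gaussian) = 1" .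
qed

lemma sets_std_gaussian [simp, measurable_cong]:
  "sets (std_gaussian :: (real ^ 'n) measure) = sets borel"
  by (simp add: std_gaussian_def)

lemma space_std_gaussian [simp]: "space (std_gaussian :: (real ^ 'n) measure) = UNIV"
  by (simp add: std_gaussian_def)

lemma nn_integral_lborel_affine:
  fixes h :: "'a::euclidean_space \<Rightarrow> ennreal"
  assumes [measurable]: "h \<in> borel_measurable borel" and "c \<noteq> 0"
  shows "(\<integral>\<^sup>+x. h x \<partial>lborel) = (\<integral>\<^sup>+x. ennreal (\<bar>c\<bar> ^ DIM('a)) * h (t + c *\<^sub>R x) \<partial>lborel)"
  by (subst lborel_affine[OF assms(2), of t])
    (simp add: nn_integral_density nn_integral_distr)

text \<open>Detailed balance for the Mehler kernel. If \<open>x\<close> is standard Gaussian and is replaced by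
  \<open>y = c x + s \<xi>\<close>, then \<open>\<xi> = (y - c x) / s\<close>, so the joint density of \<open>(x, y)\<close> is proportional
  to the left-hand side. Because \<open>c\<^sup>2 + s\<^sup>2 = 1\<close>, the sum of the two squared norms in the exponent
  is \<open>(|x|\<^sup>2 + |y|\<^sup>2 - 2 c (x \<bullet> y)) / s\<^sup>2\<close>, which does not change when \<open>x\<close> and \<open>y\<close> are
  exchanged.\<close>

lemma gaussian_kernel_symmetric:
  fixes x y :: "real ^ 'n"
  assumes "c\<^sup>2 + s\<^sup>2 = 1" "s \<noteq> 0"
  defines "g \<equiv> \<lambda>x::real ^ 'n. \<Prod>i\<in>UNIV. std_normal_density (x $ i)"
  shows "g x * g ((- c / s) *\<^sub>R x + (1 / s) *\<^sub>R y) = g y * g ((- c / s) *\<^sub>R y + (1 / s) *\<^sub>R x)"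
proof -
  have eq: "(norm x)\<^sup>2 + (norm ((- c / s) *\<^sub>R x + (1 / s) *\<^sub>R y))\<^sup>2
      = ((norm x)\<^sup>2 + (norm y)\<^sup>2 - 2 * c * (x \<bullet> y)) / s\<^sup>2" for x y :: "real ^ 'n"
  proof -
    have "s\<^sup>2 * ((norm x)\<^sup>2 + (norm ((- c / s) *\<^sub>R x + (1 / s) *\<^sub>R y))\<^sup>2)
      = s\<^sup>2 * (norm x)\<^sup>2 + (norm (s *\<^sub>R ((- c / s) *\<^sub>R x + (1 / s) *\<^sub>R y)))\<^sup>2"
      by (simp only: distrib_left norm_scaleR power_mult_distrib power2_abs)
    also have "s *\<^sub>R ((- c / s) *\<^sub>R x + (1 / s) *\<^sub>R y) = y - c *\<^sub>R x"
      using assms(2) by (simp add: algebra_simps)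
    also have "(norm (y - c *\<^sub>R x))\<^sup>2 = (norm y)\<^sup>2 + c\<^sup>2 * (norm x)\<^sup>2 - 2 * c * (x \<bullet> y)"
      unfolding power2_norm_eq_inner
      by (simp add: inner_diff_left inner_diff_right inner_commute power2_eq_square algebra_simps)
    also have "s\<^sup>2 * (norm x)\<^sup>2 + \<dots> = (c\<^sup>2 + s\<^sup>2) * (norm x)\<^sup>2 + (norm y)\<^sup>2 - 2 * c * (x \<bullet> y)"
      by (simp add: algebra_simps)
    finally show ?thesis
      using assms by (simp add: nonzero_eq_divide_eq mult.commute)
  qed
  show ?thesis
    using eq[of x y] eq[of y x]
    unfolding g_def prod_std_normal_density
    by (simp add: exp_add[symmetric] add_divide_distrib[symmetric] inner_commute add.commute
        flip: minus_add_distrib)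
qed

text \<open>A reversible kernel preserves the measure with respect to which it is reversible. Changing
  the variable \<open>\<xi>\<close> to the new momentum \<open>y\<close> and exchanging the two states by
  \<open>gaussian_kernel_symmetric\<close>, the integral over the old momentum \<open>p\<close> becomes the total mass of
  a Gaussian density, which is 1. This derives the invariance under the rotation of \<open>(p, \<xi>)\<close>
  from affine changes of one variable at a time and Tonelli's theorem.\<close>

lemma distr_std_gaussian_rotation:
  assumes cs: "c\<^sup>2 + s\<^sup>2 = 1" "s \<noteq> (0::real)"
  shows "distr (std_gaussian \<Otimes>\<^sub>M std_gaussian) borel (\<lambda>(p, \<xi>). c *\<^sub>R p + s *\<^sub>R \<xi>)
    = (std_gaussian :: (real ^ 'n) measure)"
proof (rule measure_eqI)
  let ?g = "\<lambda>x::real ^ 'n. \<Prod>i\<in>UNIV. std_normal_density (x $ i)"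
  let ?G = "std_gaussian :: (real ^ 'n) measure"
  let ?T = "\<lambda>(p::real ^ 'n, \<xi>). c *\<^sub>R p + s *\<^sub>R \<xi>"
  let ?k = "ennreal (\<bar>1 / s\<bar> ^ DIM(real ^ 'n))"
  \<comment> \<open>The value of the Gaussian increment that moves the state \<open>x\<close> to \<open>y\<close>.\<close>
  let ?m = "\<lambda>x y::real ^ 'n. (- c / s) *\<^sub>R x + (1 / s) *\<^sub>R y"
  interpret G: prob_space ?G by (rule prob_space_std_gaussian)
  show "sets (distr (?G \<Otimes>\<^sub>M ?G) borel ?T) = sets ?G" by simp
  fix A assume "A \<in> sets (distr (?G \<Otimes>\<^sub>M ?G) borel ?T)"
  then have [measurable]: "A \<in> sets borel" by simp
  have T: "c *\<^sub>R p + s *\<^sub>R ?m p y = y" for p y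
    using cs(2) by (simp add: algebra_simps)
  have mass: "(\<integral>\<^sup>+p. ?k * ennreal (?g (?m y p)) \<partial>lborel) = 1" for y
  proof -
    have "(\<integral>\<^sup>+p. ?k * ennreal (?g (?m y p)) \<partial>lborel) = (\<integral>\<^sup>+p. ennreal (?g p) \<partial>lborel)"
      using cs(2) by (intro nn_integral_lborel_affine[symmetric]) auto
    also have "\<dots> = 1"
      using G.emeasure_space_1 by (simp add: std_gaussian_def emeasure_density)
    finally show ?thesis .
  qed
  have change_of_variable: "(\<integral>\<^sup>+\<xi>. ennreal (?g \<xi>) * indicator A (c *\<^sub>R p + s *\<^sub>R \<xi>) \<partial>lborel)
      = (\<integral>\<^sup>+y. ?k * (ennreal (?g (?m p y)) * indicator A y) \<partial>lborel)" for p
  proof -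
    have "(\<integral>\<^sup>+\<xi>. ennreal (?g \<xi>) * indicator A (c *\<^sub>R p + s *\<^sub>R \<xi>) \<partial>lborel)
        = (\<integral>\<^sup>+y. ?k * (ennreal (?g (?m p y)) * indicator A (c *\<^sub>R p + s *\<^sub>R ?m p y)) \<partial>lborel)"
      using cs(2) by (intro nn_integral_lborel_affine) auto
    then show ?thesis by (simp only: T)
  qed
  have g0: "0 \<le> ?g x" for x by (simp add: prod_nonneg)
  have "emeasure (distr (?G \<Otimes>\<^sub>M ?G) borel ?T) A
      = (\<integral>\<^sup>+x. indicator A x \<partial>distr (?G \<Otimes>\<^sub>M ?G) borel ?T)"
    by simp
  also have "\<dots> = (\<integral>\<^sup>+z. indicator A (?T z) \<partial>(?G \<Otimes>\<^sub>M ?G))"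
    by (rule nn_integral_distr) simp_all
  also have "\<dots> = (\<integral>\<^sup>+p. \<integral>\<^sup>+\<xi>. indicator A (c *\<^sub>R p + s *\<^sub>R \<xi>) \<partial>?G \<partial>?G)"
    by (subst G.nn_integral_fst[symmetric]) auto
  also have "\<dots> = (\<integral>\<^sup>+p. ennreal (?g p) *
      (\<integral>\<^sup>+\<xi>. ennreal (?g \<xi>) * indicator A (c *\<^sub>R p + s *\<^sub>R \<xi>) \<partial>lborel) \<partial>lborel)"
    by (simp add: std_gaussian_def nn_integral_density)
  also have "\<dots> = (\<integral>\<^sup>+p. ennreal (?g p) *
      (\<integral>\<^sup>+y. ?k * (ennreal (?g (?m p y)) * indicator A y) \<partial>lborel) \<partial>lborel)"
    by (simp only: change_of_variable)
  also have "\<dots> = (\<integral>\<^sup>+p. \<integral>\<^sup>+y. ennreal (?g p) * (?k * (ennreal (?g (?m p y)) * indicator A y)) \<partial>lborel \<partial>lborel)"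
    by (simp add: nn_integral_cmult)
  also have "\<dots> = (\<integral>\<^sup>+y. \<integral>\<^sup>+p. ennreal (?g p) * (?k * (ennreal (?g (?m p y)) * indicator A y)) \<partial>lborel \<partial>lborel)"
    by (rule lborel_pair.Fubini') measurable
  also have "\<dots> = (\<integral>\<^sup>+y. \<integral>\<^sup>+p. (ennreal (?g y) * indicator A y) * (?k * ennreal (?g (?m y p))) \<partial>lborel \<partial>lborel)"
  proof (intro nn_integral_cong)
    fix y p
    have "ennreal (?g p) * (?k * (ennreal (?g (?m p y)) * indicator A y))
        = (ennreal (?g p) * ennreal (?g (?m p y))) * (?k * indicator A y)"
      by (simp only: ac_simps)
    also have "ennreal (?g p) * ennreal (?g (?m p y)) = ennreal (?g y) * ennreal (?g (?m y p))"
      by (simp only: ennreal_mult[OF g0 g0, symmetric] gaussian_kernel_symmetric[OF cs, of p y])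
    also have "(ennreal (?g y) * ennreal (?g (?m y p))) * (?k * indicator A y)
        = (ennreal (?g y) * indicator A y) * (?k * ennreal (?g (?m y p)))"
      by (simp only: ac_simps)
    finally show "ennreal (?g p) * (?k * (ennreal (?g (?m p y)) * indicator A y))
        = (ennreal (?g y) * indicator A y) * (?k * ennreal (?g (?m y p)))" .
  qed
  also have "\<dots> = (\<integral>\<^sup>+y. (ennreal (?g y) * indicator A y) * (\<integral>\<^sup>+p. ?k * ennreal (?g (?m y p)) \<partial>lborel) \<partial>lborel)"
    by (intro nn_integral_cong nn_integral_cmult) simp
  also have "\<dots> = emeasure ?G A"
    unfolding mass by (simp add: std_gaussian_def emeasure_density)
  finally show "emeasure (distr (?G \<Otimes>\<^sub>M ?G) borel ?T) A = emeasure ?G A" .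
qed

section \<open>Integrals of directional derivatives\<close>

text \<open>The complement of a compact set is open, so the function vanishes near the point.\<close>

lemma has_derivative_zero_outside_support:
  fixes g :: "'a::euclidean_space \<Rightarrow> real"
  assumes "(g has_derivative D) (at x)" "compact K" "\<And>y. y \<notin> K \<Longrightarrow> g y = 0" "x \<notin> K"
  shows "D v = 0"
proof -
  have "((\<lambda>_. 0::real) has_derivative D) (at x)"
    by (rule has_derivative_transform_within_open[OF assms(1), of "- K"])
      (use assms in \<open>auto intro: compact_imp_closed\<close>)
  then have "D = (\<lambda>_. 0)"
    by (rule has_derivative_unique[OF _ has_derivative_const])
  then show ?thesis by simp
qed

lemma bounded_if_compact_support:
  fixes g :: "'a::euclidean_space \<Rightarrow> real"
  assumes "continuous_on UNIV g" "compact K" "\<And>x. x \<notin> K \<Longrightarrow> g x = 0"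
  obtains B where "\<And>x. \<bar>g x\<bar> \<le> B"
proof -
  have "bounded (g ` K)"
    using assms by (meson compact_continuous_image compact_imp_bounded continuous_on_subset subset_UNIV)
  then obtain B where "\<And>x. x \<in> K \<Longrightarrow> \<bar>g x\<bar> \<le> B" by (auto simp: bounded_iff)
  then have "\<bar>g x\<bar> \<le> max B 0" for x
    using assms(3)[of x] by (cases "x \<in> K") fastforce+
  then show ?thesis by (rule that)
qed

lemma integrable_if_compact_support:
  fixes g :: "'a::euclidean_space \<Rightarrow> real"
  assumes "continuous_on UNIV g" "compact K" "\<And>x. x \<notin> K \<Longrightarrow> g x = 0"
  shows "integrable lborel g"
proof -
  have "integrable lborel (\<lambda>x. indicator K x *\<^sub>R g x)"
    using assms by (intro borel_integrable_compact) (auto intro: continuous_on_subset)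
  also have "(\<lambda>x. indicator K x *\<^sub>R g x) = g"
    by (rule ext) (auto simp: indicator_def assms(3))
  finally show ?thesis .
qed

text \<open>The integral of \<open>x \<mapsto> g (x + t v)\<close> is independent of \<open>t\<close>, because Lebesgue measure is
  translation invariant. Its derivative at \<open>t = 0\<close> is therefore 0, and dominated convergence
  identifies this derivative with the integral of the directional derivative.\<close>

lemma integral_directional_derivative_eq_0:
  fixes g :: "'a::euclidean_space \<Rightarrow> real"
  assumes D: "\<And>x. (g has_derivative D x) (at x)"
    and cont: "continuous_on UNIV (\<lambda>x. D x v)"
    and K: "compact K" "\<And>x. x \<notin> K \<Longrightarrow> g x = 0"
  shows "(\<integral>x. D x v \<partial>lborel) = 0"
proof -
  have cg: "continuous_on UNIV g"
    by (meson D continuous_at_imp_continuous_on has_derivative_continuous)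
  note [measurable] = borel_measurable_continuous_onI[OF cont] borel_measurable_continuous_onI[OF cg]
  have D0: "x \<notin> K \<Longrightarrow> D x v = 0" for x
    using has_derivative_zero_outside_support[OF D K] .
  obtain B where B: "\<And>x. \<bar>D x v\<bar> \<le> B"
    using bounded_if_compact_support[OF cont K(1) D0] by blast
  have line: "((\<lambda>t. g (x + t *\<^sub>R v)) has_real_derivative D (x + t *\<^sub>R v) v) (at t)" for x t
  proof -
    have "((\<lambda>t. g (x + t *\<^sub>R v)) has_derivative (\<lambda>h. D (x + t *\<^sub>R v) (h *\<^sub>R v))) (at t)"
      by (rule has_derivative_compose[OF _ D]) (auto intro!: derivative_eq_intros)
    also have "(\<lambda>h. D (x + t *\<^sub>R v) (h *\<^sub>R v)) = (*) (D (x + t *\<^sub>R v) v)"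
      using linear_scale[OF has_derivative_linear[OF D]] by (auto simp: mult.commute)
    finally show ?thesis by (simp add: has_field_derivative_def)
  qed
  define u where "u n = inverse (real (Suc n))" for n
  have u: "0 < u n" "u n \<le> 1" for n by (auto simp: u_def field_simps)
  \<comment> \<open>For every step \<open>t\<close> in \<open>[0, 1]\<close>, the difference quotients are supported in this compact set.\<close>
  define K' where "K' = (\<lambda>(x, t). x - t *\<^sub>R v) ` (K \<times> {0..1})"
  have K': "compact K'"
    unfolding K'_def by (intro compact_continuous_image compact_Times K)
      (auto simp: case_prod_beta intro!: continuous_intros)
  have memK': "x + t *\<^sub>R v \<in> K \<Longrightarrow> 0 \<le> t \<Longrightarrow> t \<le> 1 \<Longrightarrow> x \<in> K'" for x t
    unfolding K'_def by (rule image_eqI[of _ _ "(x + t *\<^sub>R v, t)"]) auto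
  define q where "q n x = (g (x + u n *\<^sub>R v) - g x) / u n" for n x
  have ig: "integrable lborel g" by (rule integrable_if_compact_support[OF cg K])
  have q0: "(\<integral>x. q n x \<partial>lborel) = 0" for n
  proof -
    have tr: "distr lborel borel ((+) (u n *\<^sub>R v)) = (lborel :: 'a measure)"
      by (rule lborel_distr_plus)
    have "integrable lborel (\<lambda>x. g (u n *\<^sub>R v + x))"
      using integrable_distr[of "(+) (u n *\<^sub>R v)" lborel borel g] ig unfolding tr by simp
    moreover have "(\<integral>x. g (u n *\<^sub>R v + x) \<partial>lborel) = (\<integral>x. g x \<partial>lborel)"
      using integral_distr[of "(+) (u n *\<^sub>R v)" lborel borel g] unfolding tr by simp
    ultimately show ?thesis
      unfolding q_def using ig by (simp add: add.commute)
  qed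
  have "(\<lambda>n. \<integral>x. q n x \<partial>lborel) \<longlonglongrightarrow> (\<integral>x. D x v \<partial>lborel)"
  proof (rule integral_dominated_convergence)
    show "integrable lborel (\<lambda>x. indicator K' x *\<^sub>R B)"
      using K' by (intro borel_integrable_compact) auto
    show "q n \<in> borel_measurable lborel" for n
      unfolding q_def by measurable
    show "AE x in lborel. (\<lambda>n. q n x) \<longlonglongrightarrow> D x v"
    proof (rule AE_I2)
      fix x
      have "((\<lambda>t. (g (x + t *\<^sub>R v) - g x) / t) \<longlongrightarrow> D x v) (at 0)"
        using line[of x 0] by (simp add: DERIV_def)
      moreover have "filterlim u (at 0) sequentially"
        using LIMSEQ_inverse_real_of_nat
        by (auto simp: filterlim_at u_def[abs_def] intro!: always_eventually)
      ultimately show "(\<lambda>n. q n x) \<longlonglongrightarrow> D x v"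
        unfolding q_def by (rule filterlim_compose)
    qed
    show "AE x in lborel. norm (q n x) \<le> indicator K' x *\<^sub>R B" for n
    proof (rule AE_I2)
      fix x
      \<comment> \<open>By the mean value theorem, every difference quotient is a value of the derivative.\<close>
      obtain t where t: "0 < t" "t < u n" "g (x + u n *\<^sub>R v) - g x = (u n - 0) * D (x + t *\<^sub>R v) v"
        using MVT2[of 0 "u n" "\<lambda>t. g (x + t *\<^sub>R v)", OF u(1) line] by auto
      then have "q n x = D (x + t *\<^sub>R v) v"
        using u[of n] by (simp add: q_def)
      moreover have "D (x + t *\<^sub>R v) v = 0" if "x \<notin> K'"
        using memK'[of x t] t(1,2) u(2)[of n] that by (intro D0) auto
      ultimately show "norm (q n x) \<le> indicator K' x *\<^sub>R B"
        using B by (auto simp: indicator_def)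
    qed
  qed measurable
  then show ?thesis by (simp add: q0 LIMSEQ_const_iff)
qed

section \<open>Gradients and continuous differentiability\<close>

text \<open>Gives access to the gradient, which is defined by a definite description: the Riesz
  representative of the derivative exists, and it is unique.\<close>

lemma frechet_derivative_eq_inner_grad:
  assumes "g differentiable (at x)"
  shows "frechet_derivative g (at x) h = h \<bullet> grad g x"
proof -
  let ?D = "frechet_derivative g (at x)"
  let ?d = "\<Sum>b\<in>Basis. ?D b *\<^sub>R b"
  have D: "(g has_derivative ?D) (at x)"
    using assms frechet_derivative_works by blast
  interpret linear ?D by (rule has_derivative_linear[OF D])
  have eq: "?D h = h \<bullet> ?d" for h
    by (subst (1) euclidean_representation[of h, symmetric])
      (simp add: sum scale inner_sum_right mult.commute)
  have d: "GDERIV g x :> ?d"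
    unfolding gderiv_def using D by (simp add: eq[symmetric])
  have "grad g x = ?d"
    unfolding grad_def
  proof (rule the_equality)
    show "GDERIV g x :> ?d" by (rule d)
  next
    fix e assume "GDERIV g x :> e"
    then have "(\<lambda>h. h \<bullet> e) = (\<lambda>h. h \<bullet> ?d)"
      using d unfolding gderiv_def by (rule has_derivative_unique)
    then have "\<forall>h. h \<bullet> e = h \<bullet> ?d" by (rule fun_cong[THEN allI])
    then show "e = ?d" by (rule vector_eq_ldot[THEN iffD1])
  qed
  with eq show ?thesis by (rule back_subst[of "\<lambda>d. ?D h = h \<bullet> d", OF _ sym])
qed

lemma C_k_imp_continuous: "C_k k g \<Longrightarrow> continuous_on UNIV g"
  by (cases k) (auto intro!: continuous_at_imp_continuous_on differentiable_imp_continuous_within)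

lemma C_k_Suc_imp_C_k: "C_k (Suc k) g \<Longrightarrow> C_k k g"
proof (induction k arbitrary: g)
  case 0
  then show ?case by (simp only: C_k_imp_continuous C_k.simps(1))
next
  case (Suc k)
  from Suc.prems show ?case
    unfolding C_k.simps(2)[of "Suc k" g] C_k.simps(2)[of k g] using Suc.IH by blast
qed

text \<open>The class \<open>C_k (Suc k)\<close> only provides continuity in the base point for each fixed direction.
  Here the direction varies too: expanding it in the basis reduces the claim to
  finitely many fixed directions.\<close>

lemma continuous_on_frechet_derivative:
  assumes "C_k (Suc k) g" and "continuous_on S x" "continuous_on S h"
  shows "continuous_on S (\<lambda>s. frechet_derivative g (at (x s)) (h s))"
proof -
  let ?D = "\<lambda>x. frechet_derivative g (at x)"
  have diff: "g differentiable (at x)" for x using assms(1) by simp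
  have eq: "?D x h = (\<Sum>b\<in>Basis. (h \<bullet> b) * ?D x b)" for x h
  proof -
    interpret linear "?D x"
      using diff frechet_derivative_works has_derivative_linear by blast
    show ?thesis
      by (subst (1) euclidean_representation[of h, symmetric]) (simp add: sum scale)
  qed
  have "continuous_on UNIV (\<lambda>x. ?D x b)" for b
    using assms(1) by (auto intro: C_k_imp_continuous)
  then have "continuous_on S (\<lambda>s. ?D (x s) b)" for b
    using assms(2) continuous_on_compose2 by blast
  then have "continuous_on S (\<lambda>s. \<Sum>b\<in>Basis. (h s \<bullet> b) * ?D (x s) b)"
    using assms(3) by (intro continuous_intros)
  then show ?thesis
    by (simp only: eq[symmetric])
qed

section \<open>Integration by parts against Gibbs weights\<close>

text \<open>The integrand is the derivative of \<open>exp (- U) * g\<close> along \<open>v\<close>. Positions and momenta are two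
  instances: \<open>U = \<Phi>\<close> and \<open>U = |p|\<^sup>2 / 2\<close>.\<close>

lemma integral_gibbs_by_parts:
  fixes g U :: "'a::euclidean_space \<Rightarrow> real"
  assumes g: "\<And>x. (g has_derivative Dg x) (at x)" "continuous_on UNIV (\<lambda>x. Dg x v)"
    and U: "\<And>x. (U has_derivative DU x) (at x)" "continuous_on UNIV (\<lambda>x. DU x v)"
    and K: "compact K" "\<And>x. x \<notin> K \<Longrightarrow> g x = 0"
  shows "(\<integral>x. exp (- U x) * (Dg x v - g x * DU x v) \<partial>lborel) = 0"
proof -
  have c: "continuous_on UNIV g" "continuous_on UNIV U"
    by (meson g(1) U(1) continuous_at_imp_continuous_on has_derivative_continuous)+
  have "(\<integral>x. (\<lambda>h. exp (- U x) * (Dg x h - g x * DU x h)) v \<partial>lborel) = 0"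
  proof (rule integral_directional_derivative_eq_0[where g="\<lambda>x. exp (- U x) * g x"])
    show "((\<lambda>x. exp (- U x) * g x) has_derivative
        (\<lambda>h. exp (- U x) * (Dg x h - g x * DU x h))) (at x)" for x
      by (auto intro!: derivative_eq_intros g(1) U(1) simp: fun_eq_iff algebra_simps)
    show "continuous_on UNIV (\<lambda>x. exp (- U x) * (Dg x v - g x * DU x v))"
      by (intro continuous_intros c g(2) U(2))
  qed (use K in auto)
  then show ?thesis by simp
qed

lemma integral_std_gaussian_by_parts:
  fixes g :: "real ^ 'n \<Rightarrow> real"
  assumes g: "\<And>x. (g has_derivative Dg x) (at x)" "continuous_on UNIV (\<lambda>x. Dg x v)"
    and K: "compact K" "\<And>x. x \<notin> K \<Longrightarrow> g x = 0"
  shows "(\<integral>x. (Dg x v - g x * (x \<bullet> v)) \<partial>std_gaussian) = 0"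
proof -
  have c: "continuous_on UNIV g"
    by (meson g(1) continuous_at_imp_continuous_on has_derivative_continuous)
  have [measurable]: "(\<lambda>x. Dg x v - g x * (x \<bullet> v)) \<in> borel_measurable borel"
    by (intro borel_measurable_continuous_onI continuous_intros c g(2))
  have "(\<integral>x. (Dg x v - g x * (x \<bullet> v)) \<partial>std_gaussian)
      = (\<integral>x. (2 * pi) powr (- real CARD('n) / 2) *
          (exp (- ((norm x)\<^sup>2 / 2)) * (Dg x v - g x * (x \<bullet> v))) \<partial>lborel)"
    unfolding std_gaussian_def prod_std_normal_density
    by (subst integral_density) (simp_all add: mult.assoc)
  also have "\<dots> = (2 * pi) powr (- real CARD('n) / 2) *
      (\<integral>x. exp (- ((norm x)\<^sup>2 / 2)) * (Dg x v - g x * (x \<bullet> v)) \<partial>lborel)"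
    by (rule integral_mult_right_zero)
  also have "(\<integral>x. exp (- ((norm x)\<^sup>2 / 2)) * (Dg x v - g x * (x \<bullet> v)) \<partial>lborel) = 0"
    \<comment> \<open>The potential \<open>|x|\<^sup>2 / 2\<close> has the derivative \<open>x \<bullet> v\<close> along \<open>v\<close>.\<close>
    unfolding power2_norm_eq_inner
    by (rule integral_gibbs_by_parts[OF g _ _ K])
      (auto intro!: derivative_eq_intros continuous_intros simp: inner_commute)
  finally show ?thesis by simp
qed

section \<open>Product structure of the target measure\<close>

text \<open>The position marginal of \<open>Pi_BG\<close>, once \<open>exp (- \<Phi>)\<close> is integrable.\<close>

definition position_measure :: "(real ^ 'n \<Rightarrow> real) \<Rightarrow> (real ^ 'n) measure" where
  "position_measure \<Phi> = density lborel (\<lambda>q. ennreal (inverse (C0 \<Phi>) * exp (- \<Phi> q)))"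

lemma sets_position_measure [simp, measurable_cong]: "sets (position_measure \<Phi>) = sets borel"
  by (simp add: position_measure_def)

lemma C0_nonneg: "0 \<le> C0 \<Phi>"
  unfolding C0_def by (rule integral_nonneg_AE) simp

text \<open>The Hamiltonian is a sum of a function of the position and a function of the momentum, so the
  target is a product. The constant \<open>(2 * pi) powr (- n / 2)\<close> is the one that normalises the Gaussian
  factor.\<close>

lemma Pi_BG_eq_pair_measure:
  fixes \<Phi> :: "real ^ 'n \<Rightarrow> real"
  assumes [measurable]: "\<Phi> \<in> borel_measurable borel"
  shows "Pi_BG \<Phi> = position_measure \<Phi> \<Otimes>\<^sub>M std_gaussian"
proof -
  interpret G: prob_space "std_gaussian :: (real ^ 'n) measure" by (rule prob_space_std_gaussian)
  let ?g = "\<lambda>x::real ^ 'n. \<Prod>i\<in>UNIV. std_normal_density (x $ i)"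
  have "position_measure \<Phi> \<Otimes>\<^sub>M std_gaussian = density (lborel \<Otimes>\<^sub>M lborel)
      (\<lambda>(q, p). ennreal (inverse (C0 \<Phi>) * exp (- \<Phi> q)) * ennreal (?g p))"
    unfolding position_measure_def std_gaussian_def
    by (rule pair_measure_density)
      (use G.sigma_finite_measure_axioms sigma_finite_lborel in \<open>simp_all add: std_gaussian_def\<close>)
  also have "\<dots> = Pi_BG \<Phi>"
    unfolding Pi_BG_def lborel_prod
  proof (rule arg_cong[where f="density lborel"], rule ext, clarify)
    fix q p :: "real ^ 'n"
    have "exp (- Hamiltonian \<Phi> (q, p)) = exp (- \<Phi> q) * exp (- (norm p)\<^sup>2 / 2)"
      by (simp add: Hamiltonian_def exp_add[symmetric])
    then show "ennreal (inverse (C0 \<Phi>) * exp (- \<Phi> q)) * ennreal (?g p)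
      = ennreal (inverse (C0 \<Phi>) * (2 * pi) powr (- real CARD('n) / 2) * exp (- Hamiltonian \<Phi> (q, p)))"
      using C0_nonneg[of \<Phi>]
      by (subst ennreal_mult[symmetric]) (simp_all add: prod_std_normal_density ac_simps)
  qed
  finally show ?thesis by simp
qed

text \<open>Split at the unit sphere: inside, \<open>\<Phi> \<ge> 0\<close> bounds the integrand by 1; outside, the second
  moment dominates it.\<close>

lemma integrable_exp_neg_if_second_moment:
  fixes \<Phi> :: "real ^ 'n \<Rightarrow> real"
  assumes [measurable]: "\<Phi> \<in> borel_measurable borel"
    and "\<And>q. \<Phi> q \<ge> 0"
    and "integrable lborel (\<lambda>q. (norm q)\<^sup>2 * exp (- \<Phi> q))"
  shows "integrable lborel (\<lambda>q. exp (- \<Phi> q))"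
proof (rule Bochner_Integration.integrable_bound)
  show "integrable lborel
      (\<lambda>q::real ^ 'n. indicator (cball 0 1) q *\<^sub>R (1::real) + (norm q)\<^sup>2 * exp (- \<Phi> q))"
    using assms(3) by (intro Bochner_Integration.integrable_add borel_integrable_compact) auto
  show "AE q in lborel. norm (exp (- \<Phi> q))
      \<le> norm (indicator (cball 0 1) q *\<^sub>R (1::real) + (norm q)\<^sup>2 * exp (- \<Phi> q))"
  proof (rule AE_I2)
    fix q
    have "exp (- \<Phi> q) \<le> (norm q)\<^sup>2 * exp (- \<Phi> q)" if "norm q > 1"
      using that one_le_power[of "norm q" 2] by simp
    then show "norm (exp (- \<Phi> q))
        \<le> norm (indicator (cball 0 1) q *\<^sub>R (1::real) + (norm q)\<^sup>2 * exp (- \<Phi> q))"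
      using assms(2)[of q] by (cases "norm q \<le> 1") (auto simp: indicator_def add_increasing2)
  qed
qed measurable

lemma finite_measure_position_measure:
  assumes "integrable lborel (\<lambda>q. exp (- \<Phi> q))"
  shows "finite_measure (position_measure \<Phi>)"
proof
  have I: "integrable lborel (\<lambda>q. inverse (C0 \<Phi>) * exp (- \<Phi> q))"
    using assms by simp
  then show "emeasure (position_measure \<Phi>) (space (position_measure \<Phi>)) \<noteq> \<infinity>"
    using integrableD(2)[OF I] borel_measurable_integrable[OF I] C0_nonneg[of \<Phi>]
    by (simp add: position_measure_def emeasure_density abs_mult)
qed

lemma integral_position_measure_by_parts:
  fixes g \<Phi> :: "real ^ 'n \<Rightarrow> real"
  assumes g: "\<And>x. (g has_derivative Dg x) (at x)" "continuous_on UNIV (\<lambda>x. Dg x v)"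
    and U: "\<And>x. (\<Phi> has_derivative D\<Phi> x) (at x)" "continuous_on UNIV (\<lambda>x. D\<Phi> x v)"
    and K: "compact K" "\<And>x. x \<notin> K \<Longrightarrow> g x = 0"
  shows "(\<integral>x. (Dg x v - g x * D\<Phi> x v) \<partial>position_measure \<Phi>) = 0"
proof -
  have c: "continuous_on UNIV g" "continuous_on UNIV \<Phi>"
    by (meson g(1) U(1) continuous_at_imp_continuous_on has_derivative_continuous)+
  have [measurable]: "(\<lambda>x. Dg x v - g x * D\<Phi> x v) \<in> borel_measurable borel"
    "\<Phi> \<in> borel_measurable borel"
    by (intro borel_measurable_continuous_onI continuous_intros c g(2) U(2))+
  have "(\<integral>x. (Dg x v - g x * D\<Phi> x v) \<partial>position_measure \<Phi>)
      = (\<integral>x. inverse (C0 \<Phi>) * (exp (- \<Phi> x) * (Dg x v - g x * D\<Phi> x v)) \<partial>lborel)"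
    unfolding position_measure_def using C0_nonneg[of \<Phi>]
    by (subst integral_density) (simp_all add: mult.assoc)
  also have "\<dots> = inverse (C0 \<Phi>) * (\<integral>x. exp (- \<Phi> x) * (Dg x v - g x * D\<Phi> x v) \<partial>lborel)"
    by (rule integral_mult_right_zero)
  also have "(\<integral>x. exp (- \<Phi> x) * (Dg x v - g x * D\<Phi> x v) \<partial>lborel) = 0"
    by (rule integral_gibbs_by_parts[OF g U K])
  finally show ?thesis by simp
qed

section \<open>Invariance under momentum refreshment\<close>

lemma integral_std_gaussian_rotation:
  fixes h :: "real ^ 'n \<Rightarrow> real"
  assumes cs: "c\<^sup>2 + s\<^sup>2 = 1" "s \<noteq> 0"
    and [measurable]: "h \<in> borel_measurable borel" and B: "\<And>x. \<bar>h x\<bar> \<le> B"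
  shows "(\<integral>p. (\<integral>\<xi>. h (c *\<^sub>R p + s *\<^sub>R \<xi>) \<partial>std_gaussian) \<partial>std_gaussian) = (\<integral>p. h p \<partial>std_gaussian)"
proof -
  let ?G = "std_gaussian :: (real ^ 'n) measure"
  interpret G: prob_space ?G by (rule prob_space_std_gaussian)
  interpret GG: pair_prob_space ?G ?G ..
  have "integrable (?G \<Otimes>\<^sub>M ?G) (\<lambda>(p, \<xi>). h (c *\<^sub>R p + s *\<^sub>R \<xi>))"
    using B by (intro GG.integrable_const_bound[where B=B]) auto
  from GG.integral_fst'[OF this]
  have "(\<integral>p. (\<integral>\<xi>. h (c *\<^sub>R p + s *\<^sub>R \<xi>) \<partial>?G) \<partial>?G)
      = (\<integral>z. h (case z of (p, \<xi>) \<Rightarrow> c *\<^sub>R p + s *\<^sub>R \<xi>) \<partial>(?G \<Otimes>\<^sub>M ?G))"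
    by (simp add: case_prod_unfold)
  also have "\<dots> = (\<integral>p. h p \<partial>distr (?G \<Otimes>\<^sub>M ?G) borel (\<lambda>(p, \<xi>). c *\<^sub>R p + s *\<^sub>R \<xi>))"
    by (rule integral_distr[symmetric]) measurable
  finally show ?thesis
    by (simp only: distr_std_gaussian_rotation[OF cs])
qed

text \<open>For a fixed position the refreshment replaces \<open>p\<close> by \<open>cos \<phi> p + sin \<phi> \<xi>\<close>, which is again standard
  Gaussian. Hence the integral over the momentum alone already vanishes, for every position.\<close>

lemma momentum_refreshment_preserves:
  fixes f :: "(real ^ 'n) \<times> (real ^ 'n) \<Rightarrow> real"
  assumes "finite_measure M" and [simp, measurable_cong]: "sets M = sets borel"
    and f: "f \<in> borel_measurable borel" and B: "\<And>z. \<bar>f z\<bar> \<le> B"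
    and "sin \<phi> \<noteq> 0"
  defines "J \<equiv> \<lambda>z. \<integral>\<xi>. (f (Gamma_map \<phi> z \<xi>) - f z) \<partial>std_gaussian"
  shows "integrable (M \<Otimes>\<^sub>M std_gaussian) J"
    and "(\<integral>z. J z \<partial>(M \<Otimes>\<^sub>M std_gaussian)) = 0"
proof -
  let ?G = "std_gaussian :: (real ^ 'n) measure"
  interpret M: finite_measure M by fact
  interpret G: prob_space ?G by (rule prob_space_std_gaussian)
  interpret MG: pair_sigma_finite M ?G ..
  interpret F: finite_measure "M \<Otimes>\<^sub>M ?G"
    by (intro finite_measure_pair_measure M.finite_measure_axioms G.finite_measure_axioms)
  have [measurable]: "f \<in> borel_measurable (borel \<Otimes>\<^sub>M borel)"
    using f by (simp add: borel_prod)
  have bounds: "f z \<le> B" "- B \<le> f z" for z using B[of z] by auto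
  have int: "integrable ?G (\<lambda>\<xi>. f (q, cos \<phi> *\<^sub>R p + sin \<phi> *\<^sub>R \<xi>))" "integrable ?G (\<lambda>p. f (q, p))" for q p
    using B by (auto intro!: G.integrable_const_bound[where B=B])
  have J: "J (q, p) = (\<integral>\<xi>. f (q, cos \<phi> *\<^sub>R p + sin \<phi> *\<^sub>R \<xi>) \<partial>?G) - f (q, p)" for q p
    unfolding J_def Gamma_map_def using int(1) G.prob_space by simp
  have meas: "(\<lambda>z. \<integral>\<xi>. f (fst z, cos \<phi> *\<^sub>R snd z + sin \<phi> *\<^sub>R \<xi>) \<partial>?G) \<in> borel_measurable (M \<Otimes>\<^sub>M ?G)"
    by measurable
  have bd: "\<bar>\<integral>\<xi>. f (q, cos \<phi> *\<^sub>R p + sin \<phi> *\<^sub>R \<xi>) \<partial>?G\<bar> \<le> B" for q p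
    using G.integral_le_const[OF int(1)[of q p], of B] G.integral_ge_const[OF int(1)[of q p], of "- B"]
    by (auto simp: bounds abs_le_iff)
  have Jb: "\<bar>J z\<bar> \<le> 2 * B" for z
    using B[of z] bd[of "fst z" "snd z"] J[of "fst z" "snd z"] by simp
  have "(\<lambda>z. (\<integral>\<xi>. f (fst z, cos \<phi> *\<^sub>R snd z + sin \<phi> *\<^sub>R \<xi>) \<partial>?G) - f z) \<in> borel_measurable (M \<Otimes>\<^sub>M ?G)"
    using meas by measurable
  also have "(\<lambda>z. (\<integral>\<xi>. f (fst z, cos \<phi> *\<^sub>R snd z + sin \<phi> *\<^sub>R \<xi>) \<partial>?G) - f z) = J"
    using J by (auto simp: fun_eq_iff)
  finally have Jm: "J \<in> borel_measurable (M \<Otimes>\<^sub>M ?G)" .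
  show Ji: "integrable (M \<Otimes>\<^sub>M ?G) J"
    using Jb Jm by (intro F.integrable_const_bound[where B="2 * B"]) auto
  have "(\<integral>p. J (q, p) \<partial>?G) = 0" for q
  proof -
    have "integrable ?G (\<lambda>p. \<integral>\<xi>. f (q, cos \<phi> *\<^sub>R p + sin \<phi> *\<^sub>R \<xi>) \<partial>?G)"
      using bd by (intro G.integrable_const_bound[where B=B]) auto
    then have "(\<integral>p. J (q, p) \<partial>?G)
        = (\<integral>p. (\<integral>\<xi>. f (q, cos \<phi> *\<^sub>R p + sin \<phi> *\<^sub>R \<xi>) \<partial>?G) \<partial>?G) - (\<integral>p. f (q, p) \<partial>?G)"
      unfolding J using int(2) by (rule Bochner_Integration.integral_diff)
    also have "\<dots> = 0"
      using integral_std_gaussian_rotation[of "cos \<phi>" "sin \<phi>" "\<lambda>p. f (q, p)" B] assms(5) B by simp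
    finally show ?thesis .
  qed
  then show "(\<integral>z. J z \<partial>(M \<Otimes>\<^sub>M ?G)) = 0"
    using MG.integral_fst'[OF Ji] by simp
qed

section \<open>Invariance under Hamiltonian transport\<close>

text \<open>Liouville's theorem together with conservation of energy, in integrated form. Subtract the same
  function \<open>f (q, p) * (p \<bullet> grad \<Phi> q)\<close> from both parts of the transport term, which leaves their
  difference unchanged. What remains of the first part is a derivative along \<open>p\<close> in the position
  variable, integrated against \<open>exp (- \<Phi>)\<close>; it integrates to zero over \<open>q\<close> for each fixed \<open>p\<close>. What
  remains of the second part is a derivative along \<open>grad \<Phi> q\<close> in the momentum variable, integrated
  against the Gaussian; it integrates to zero over \<open>p\<close> for each fixed \<open>q\<close>. In both cases the
  direction does not depend on the variable of integration.\<close>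

lemma transport_preserves:
  fixes \<Phi> :: "real ^ 'n \<Rightarrow> real" and f :: "(real ^ 'n) \<times> (real ^ 'n) \<Rightarrow> real"
  assumes \<Phi>: "C_k 1 \<Phi>" and fin: "finite_measure (position_measure \<Phi>)"
    and f: "C_k 1 f" and K: "compact K" "\<And>z. z \<notin> K \<Longrightarrow> f z = 0"
  defines "T \<equiv> \<lambda>(q, p). p \<bullet> grad (\<lambda>q'. f (q', p)) q - grad \<Phi> q \<bullet> grad (\<lambda>p'. f (q, p')) p"
  shows "integrable (position_measure \<Phi> \<Otimes>\<^sub>M std_gaussian) T"
    and "(\<integral>z. T z \<partial>(position_measure \<Phi> \<Otimes>\<^sub>M std_gaussian)) = 0"
proof -
  let ?G = "std_gaussian :: (real ^ 'n) measure"
  let ?M = "position_measure \<Phi>"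
  let ?D = "\<lambda>z. frechet_derivative f (at z)"
  let ?D\<Phi> = "\<lambda>q. frechet_derivative \<Phi> (at q)"
  interpret M: finite_measure ?M by fact
  interpret G: prob_space ?G by (rule prob_space_std_gaussian)
  interpret MG: pair_sigma_finite ?M ?G ..
  interpret F: finite_measure "?M \<Otimes>\<^sub>M ?G"
    by (intro finite_measure_pair_measure M.finite_measure_axioms G.finite_measure_axioms)
  have \<Phi>': "C_k (Suc 0) \<Phi>" and f': "C_k (Suc 0) f" using \<Phi> f by simp_all
  have Df: "(f has_derivative ?D z) (at z)" for z
    using f' by (simp add: frechet_derivative_works[symmetric] del: split_paired_All)
  have D\<Phi>: "(\<Phi> has_derivative ?D\<Phi> q) (at q)" for q
    using \<Phi>' by (simp add: frechet_derivative_works[symmetric])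
  have D\<Phi>_grad: "?D\<Phi> q h = h \<bullet> grad \<Phi> q" for q h
    using \<Phi>' by (intro frechet_derivative_eq_inner_grad) simp
  have slice_q: "((\<lambda>q'. f (q', p)) has_derivative (\<lambda>h. ?D (q, p) (h, 0))) (at q)" for q p
    by (rule has_derivative_compose[OF _ Df]) (auto intro!: derivative_eq_intros)
  have slice_p: "((\<lambda>p'. f (q, p')) has_derivative (\<lambda>h. ?D (q, p) (0, h))) (at p)" for q p
    by (rule has_derivative_compose[OF _ Df]) (auto intro!: derivative_eq_intros)
  have cf: "continuous_on UNIV f" using f' by (rule C_k_imp_continuous)
  \<comment> \<open>The sum is the expansion of \<open>grad \<Phi> q\<close> in the basis.\<close>
  have "continuous_on UNIV (\<lambda>q. \<Sum>b\<in>Basis. ?D\<Phi> q b *\<^sub>R b)"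
    by (intro continuous_intros continuous_on_frechet_derivative[OF \<Phi>'])
  then have cgrad: "continuous_on UNIV (grad \<Phi>)"
    by (simp add: D\<Phi>_grad inner_commute[of _ "grad \<Phi> _"] euclidean_representation)
  have cgrad': "continuous_on UNIV (\<lambda>z::(real ^ 'n) \<times> (real ^ 'n). grad \<Phi> (fst z))"
    by (rule continuous_on_compose2[OF cgrad]) (auto intro!: continuous_intros)
  define A where "A z = ?D z (snd z, 0) - f z * (snd z \<bullet> grad \<Phi> (fst z))" for z
  define B where "B z = ?D z (0, grad \<Phi> (fst z)) - f z * (snd z \<bullet> grad \<Phi> (fst z))" for z
  have T: "T = (\<lambda>z. A z - B z)"
  proof (rule ext, clarify)
    fix q p
    have "p \<bullet> grad (\<lambda>q'. f (q', p)) q = ?D (q, p) (p, 0)"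
      using frechet_derivative_eq_inner_grad[of "\<lambda>q'. f (q', p)" q p]
        frechet_derivative_at[OF slice_q[of p q]] slice_q[of p q]
      by (metis differentiableI)
    moreover have "grad \<Phi> q \<bullet> grad (\<lambda>p'. f (q, p')) p = ?D (q, p) (0, grad \<Phi> q)"
      using frechet_derivative_eq_inner_grad[of "\<lambda>p'. f (q, p')" p "grad \<Phi> q"]
        frechet_derivative_at[OF slice_p[of q p]] slice_p[of q p]
      by (metis differentiableI)
    ultimately show "T (q, p) = A (q, p) - B (q, p)"
      by (simp add: T_def A_def B_def)
  qed
  have D0: "?D z v = 0" if "z \<notin> K" for z v
    using has_derivative_zero_outside_support[OF Df K that] .
  have int: "integrable (?M \<Otimes>\<^sub>M ?G) h"
    if h: "continuous_on UNIV h" "\<And>z. z \<notin> K \<Longrightarrow> h z = 0" for h :: "(real ^ 'n) \<times> (real ^ 'n) \<Rightarrow> real"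
  proof -
    obtain C where "\<And>z. \<bar>h z\<bar> \<le> C"
      using bounded_if_compact_support[OF h(1) K(1) h(2)] by blast
    moreover have "h \<in> borel_measurable (?M \<Otimes>\<^sub>M ?G)"
      using borel_measurable_continuous_onI[OF h(1)]
      by (simp add: borel_prod[symmetric] cong: measurable_cong_sets sets_pair_measure_cong)
    ultimately show ?thesis
      by (intro F.integrable_const_bound[where B=C]) auto
  qed
  have A_int: "integrable (?M \<Otimes>\<^sub>M ?G) A"
    unfolding A_def
    by (intro int continuous_intros continuous_on_frechet_derivative[OF f'] cf cgrad') (simp add: D0 K)
  have B_int: "integrable (?M \<Otimes>\<^sub>M ?G) B"
    unfolding B_def
    by (intro int continuous_intros continuous_on_frechet_derivative[OF f'] cf cgrad') (simp add: D0 K)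
  have K1: "compact (fst ` K)" and K2: "compact (snd ` K)"
    using K(1) by (auto intro!: compact_continuous_image continuous_intros)
  have "(\<integral>q. A (q, p) \<partial>?M) = 0" for p
  proof -
    have "(\<integral>q. ((\<lambda>h. ?D (q, p) (h, 0)) p - f (q, p) * ?D\<Phi> q p) \<partial>?M) = 0"
    proof (rule integral_position_measure_by_parts[OF slice_q _ D\<Phi> _ K1])
      show "f (q, p) = 0" if "q \<notin> fst ` K" for q
        using that by (intro K(2)) force
    qed (intro continuous_intros continuous_on_frechet_derivative[OF f']
        continuous_on_frechet_derivative[OF \<Phi>'])+
    then show ?thesis by (simp add: A_def D\<Phi>_grad)
  qed
  then have "(\<integral>z. A z \<partial>(?M \<Otimes>\<^sub>M ?G)) = 0"
    using MG.integral_snd[of "\<lambda>q p. A (q, p)"] A_int by simp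
  moreover have "(\<integral>p. B (q, p) \<partial>?G) = 0" for q
  proof -
    have "(\<integral>p. ((\<lambda>h. ?D (q, p) (0, h)) (grad \<Phi> q) - f (q, p) * (p \<bullet> grad \<Phi> q)) \<partial>?G) = 0"
    proof (rule integral_std_gaussian_by_parts[OF slice_p _ K2])
      show "f (q, p) = 0" if "p \<notin> snd ` K" for p
        using that by (intro K(2)) force
    qed (intro continuous_intros continuous_on_frechet_derivative[OF f'])
    then show ?thesis by (simp add: B_def)
  qed
  then have "(\<integral>z. B z \<partial>(?M \<Otimes>\<^sub>M ?G)) = 0"
    using MG.integral_fst'[OF B_int] by simp
  ultimately show "(\<integral>z. T z \<partial>(?M \<Otimes>\<^sub>M ?G)) = 0"
    unfolding T using A_int B_int by simp
  show "integrable (?M \<Otimes>\<^sub>M ?G) T"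
    unfolding T using A_int B_int by simp
qed

section \<open>Invariance under the generator\<close>

theorem proposition3p1:
  fixes \<Phi> :: "real ^ 'n \<Rightarrow> real"
    and f :: "(real ^ 'n) \<times> (real ^ 'n) \<Rightarrow> real"
    and lam \<phi> :: real
  assumes "lam > 0"
    and "0 < \<phi>" and "\<phi> \<le> pi / 2"
    and "C_k 2 \<Phi>"
    and "\<And>q. \<Phi> q \<ge> 0"
    and "integrable lborel (\<lambda>q. (norm q)\<^sup>2 * exp (- \<Phi> q))"
    and "f \<in> Cc_infinity"
  shows "integrable (Pi_BG \<Phi>) (RHMC_generator lam \<phi> \<Phi> f)
    \<and> (\<integral>z. RHMC_generator lam \<phi> \<Phi> f z \<partial>Pi_BG \<Phi>) = 0"
proof -
  let ?K = "closure (support_on UNIV f)"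
  have \<Phi>1: "C_k 1 \<Phi>"
    using assms(4) C_k_Suc_imp_C_k[of 1 \<Phi>] by (simp only: Suc_1)
  have f1: "C_k 1 f" and K: "compact ?K"
    using assms(7) by (auto simp: Cc_infinity_def)
  have f0: "f z = 0" if "z \<notin> ?K" for z
    using that closure_subset[of "support_on UNIV f"] by (auto simp: in_support_on)
  have cf: "continuous_on UNIV f" using f1 by (rule C_k_imp_continuous)
  obtain B where B: "\<And>z. \<bar>f z\<bar> \<le> B"
    using bounded_if_compact_support[OF cf K f0] by blast
  have \<Phi>m: "\<Phi> \<in> borel_measurable borel"
    using \<Phi>1 by (intro borel_measurable_continuous_onI C_k_imp_continuous)
  have fin: "finite_measure (position_measure \<Phi>)"
    by (intro finite_measure_position_measure integrable_exp_neg_if_second_moment \<Phi>m assms(5,6))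
  \<comment> \<open>The noise enters with a nonzero weight, so the new momentum has a density given the old one.\<close>
  have "sin \<phi> \<noteq> 0"
    using assms(2,3) sin_gt_zero[of \<phi>] pi_gt_zero by force
  note J = momentum_refreshment_preserves[OF fin sets_position_measure
      borel_measurable_continuous_onI[OF cf] B this]
  note T = transport_preserves[OF \<Phi>1 fin f1 K f0]
  have L: "RHMC_generator lam \<phi> \<Phi> f = (\<lambda>z.
      inverse lam * (\<integral>\<xi>. (f (Gamma_map \<phi> z \<xi>) - f z) \<partial>std_gaussian)
      + (case z of (q, p) \<Rightarrow> p \<bullet> grad (\<lambda>q'. f (q', p)) q - grad \<Phi> q \<bullet> grad (\<lambda>p'. f (q, p')) p))"
    by (auto simp: RHMC_generator_def fun_eq_iff)
  show ?thesis
    unfolding Pi_BG_eq_pair_measure[OF \<Phi>m] L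
    using J T
    by (simp add: Bochner_Integration.integral_add[OF integrable_mult_right[OF J(1)] T(1)])
qed

end
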